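(* Let $d\ge2$ and $1\le k<d$. Let $E\subseteq\mathbb{F}_q^k$ and $F\subseteq\mathbb{F}_q^{d-k}$, and consider the direct sum $E\oplus F=\{(x,y):x\in E,\,y\in F\}\subseteq\mathbb{F}_q^d$. Let $p\ge1$ and suppose $E$ is $(p,s)$-Salem (as a subset of $\mathbb{F}_q^k$) and $F$ is $(p,t)$-Salem (as a subset of $\mathbb{F}_q^{d-k}$). Then $E\oplus F$ is $(p,s')$-Salem (as a subset of $\mathbb{F}_q^d$) for \[ s'=\frac{s\log(\#E)+t\log(\#F)}{\log(\#E)+\log(\#F)}\wedge\frac{\frac kp\log q+t\log(\#F)}{\log(\#E)+\log(\#F)}\wedge\frac{s\log(\#E)+\frac{d-k}{p}\log q}{\log(\#E)+\log(\#F)}. \] In particular, if $E$ is $(\infty,s)$-Salem and $F$ is $(\infty,t)$-Salem, then $E\oplus F$ is $(\infty,s')$-Salem for \[ s'=\frac{s\log(\#E)\wedge t\log(\#F)}{\log(\#E)+\log(\#F)}. \]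
   Context: $q$ is a prime power, $\chi$ a fixed non-trivial additive character of $\mathbb{F}_q$, $a\wedge b=\min\{a,b\}$. For $E\subseteq\mathbb{F}_q^n$, $\widehat E(x)=q^{-n}\sum_{y\in E}\chi(-x\cdot y)$, $\|\widehat E\|_p=\big(q^{-n}\sum_{x\in\mathbb{F}_q^n\setminus\{0\}}|\widehat E(x)|^p\big)^{1/p}$ for $p<\infty$ and $\|\widehat E\|_\infty=\sup_{x\ne0}|\widehat E(x)|$. Sets are families indexed by $q$; $A\lesssim B$ means $A\le cB$ with $c$ independent of $q$. $E\subseteq\mathbb{F}_q^n$ is $(p,s)$-Salem if $\|\widehat E\|_p\lesssim q^{-n}(\#E)^{1-s}$ (the exponent $s$ may depend on $q$). *)

theory Defs
  imports
    Complex_Main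
    "HOL-Library.Extended_Real"
    "HOL-Number_Theory.Prime_Powers"
    "HOL-Algebra.Ring"
begin

text \<open>The constants implied by \<open>\<lesssim>\<close> must be uniform in \<open>q\<close>, so one statement has to range over
  finite fields of different orders.  They are therefore carrier-based fields over a common type,
  and vectors with \<open>n\<close> entries are lists of length \<open>n\<close>.\<close>

definition vecs :: "('a, 'm) ring_scheme \<Rightarrow> nat \<Rightarrow> 'a list set" where
  "vecs K n = {x. length x = n \<and> set x \<subseteq> carrier K}"

definition zero_vec :: "('a, 'm) ring_scheme \<Rightarrow> nat \<Rightarrow> 'a list" where
  "zero_vec K n = replicate n \<zero>\<^bsub>K\<^esub>"

definition dot :: "('a, 'm) ring_scheme \<Rightarrow> nat \<Rightarrow> 'a list \<Rightarrow> 'a list \<Rightarrow> 'a" where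
  "dot K n x y = (\<Oplus>\<^bsub>K\<^esub>i\<in>{..<n}. x ! i \<otimes>\<^bsub>K\<^esub> y ! i)"

definition additive_character :: "('a, 'm) ring_scheme \<Rightarrow> ('a \<Rightarrow> complex) \<Rightarrow> bool" where
  "additive_character K \<chi> \<longleftrightarrow>
     (\<forall>x\<in>carrier K. cmod (\<chi> x) = 1) \<and>
     (\<forall>x\<in>carrier K. \<forall>y\<in>carrier K. \<chi> (x \<oplus>\<^bsub>K\<^esub> y) = \<chi> x * \<chi> y)"

definition nontrivial_additive_character :: "('a, 'm) ring_scheme \<Rightarrow> ('a \<Rightarrow> complex) \<Rightarrow> bool" where
  "nontrivial_additive_character K \<chi> \<longleftrightarrow>
     additive_character K \<chi> \<and> (\<exists>x\<in>carrier K. \<chi> x \<noteq> 1)"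

definition fourier ::
  "('a, 'm) ring_scheme \<Rightarrow> ('a \<Rightarrow> complex) \<Rightarrow> nat \<Rightarrow> 'a list set \<Rightarrow> 'a list \<Rightarrow> complex" where
  "fourier K \<chi> n E x =
     (\<Sum>y\<in>E. \<chi> (\<ominus>\<^bsub>K\<^esub> dot K n x y)) / of_nat (card (carrier K)) ^ n"

definition fourier_norm ::
  "('a, 'm) ring_scheme \<Rightarrow> ('a \<Rightarrow> complex) \<Rightarrow> nat \<Rightarrow> ereal \<Rightarrow> 'a list set \<Rightarrow> real" where
  "fourier_norm K \<chi> n p E =
     (if p = \<infinity> then (SUP x \<in> vecs K n - {zero_vec K n}. cmod (fourier K \<chi> n E x))
      else ((\<Sum>x \<in> vecs K n - {zero_vec K n}. cmod (fourier K \<chi> n E x) powr real_of_ereal p)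
              / real (card (carrier K)) ^ n) powr (1 / real_of_ereal p))"

text \<open>The field, the character, the set and the exponent are all families indexed by \<open>q \<in> Q\<close>;
  the constant \<open>c\<close> is chosen before \<open>q\<close>.\<close>

definition salem ::
  "nat set \<Rightarrow> (nat \<Rightarrow> ('a, 'm) ring_scheme) \<Rightarrow> (nat \<Rightarrow> 'a \<Rightarrow> complex) \<Rightarrow> nat \<Rightarrow> ereal \<Rightarrow>
   (nat \<Rightarrow> real) \<Rightarrow> (nat \<Rightarrow> 'a list set) \<Rightarrow> bool" where
  "salem Q K \<chi> n p s E \<longleftrightarrow>
     (\<exists>c>0. \<forall>q\<in>Q. fourier_norm (K q) (\<chi> q) n p (E q)
                     \<le> c * (real (card (E q)) powr (1 - s q) / real q ^ n))"

definition direct_sum :: "'a list set \<Rightarrow> 'a list set \<Rightarrow> 'a list set" where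
  "direct_sum E F = {x @ y | x y. x \<in> E \<and> y \<in> F}"

end

theory Submission imports Defs begin

text \<open>The Fourier transform of \<open>E \<oplus> F\<close> at \<open>(x, y)\<close> is the product of the transforms of \<open>E\<close> at \<open>x\<close>
  and of \<open>F\<close> at \<open>y\<close>.  Nonzero frequencies \<open>(x, y)\<close> split according to whether both, only \<open>y\<close>
  or only \<open>x\<close> are nonzero; since the transform of \<open>E\<close> at zero is \<open>#E / q^k\<close>, the three parts of
  the \<open>p\<close>-norm give the three terms of the minimum.  For \<open>p = \<infinity>\<close> the first part needs no term of
  its own, because the transform of \<open>E\<close> never exceeds its value at zero.  The exponent is a
  quotient by \<open>ln #E + ln #F\<close>, which is the junk value \<open>0\<close> when both sets are singletons; there
  the bound is the trivial one.\<close>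

section \<open>Powers written through logarithms\<close>

lemma powr_one_minus_eq:
  fixes x :: real
  assumes "x > 0"
  shows "x powr (1 - s) = x * exp (- (s * ln x))"
proof -
  have "x powr (1 - s) = exp (ln x + - (s * ln x))"
    using assms by (simp add: powr_def algebra_simps)
  then show ?thesis using assms by (simp only: exp_add exp_ln)
qed

text \<open>Works with \<open>s * ln x\<close> rather than \<open>s\<close>, so an inequality
  between exponents can be used with denominators cleared. The number \<open>a\<close> plays the
  role of one of the competing numerators in the minimum.\<close>

lemma mult_exp_le_powr:
  fixes x :: real
  assumes "x > 0" "s * ln x \<le> a"
  shows "x * exp (- a) \<le> x powr (1 - s)"
  using assms by (simp add: powr_one_minus_eq)

section \<open>Concatenated vectors and sums over direct sums\<close>

lemma inj_on_append: "inj_on (\<lambda>(x, y). x @ y) (vecs K m \<times> B)"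
  by (auto simp: inj_on_def vecs_def)

lemma direct_sum_eq_image: "direct_sum A B = (\<lambda>(x, y). x @ y) ` (A \<times> B)"
  by (force simp: direct_sum_def)

text \<open>All vectors of \<open>A\<close> have length \<open>m\<close>, so \<open>x @ y\<close>
  determines both halves and no term is counted twice.\<close>

lemma sum_direct_sum:
  fixes f :: "'a list \<Rightarrow> 'b :: comm_monoid_add"
  assumes "A \<subseteq> vecs K m"
  shows "sum f (direct_sum A B) = (\<Sum>x\<in>A. \<Sum>y\<in>B. f (x @ y))"
proof -
  have "inj_on (\<lambda>(x, y). x @ y) (A \<times> B)"
    using assms by (auto intro: inj_on_subset[OF inj_on_append])
  then show ?thesis
    by (simp add: direct_sum_eq_image sum.reindex sum.cartesian_product case_prod_unfold)
qed

lemma card_direct_sum: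
  assumes "A \<subseteq> vecs K m"
  shows "card (direct_sum A B) = card A * card B"
proof -
  have "inj_on (\<lambda>(x, y). x @ y) (A \<times> B)"
    using assms by (auto intro: inj_on_subset[OF inj_on_append])
  then show ?thesis
    by (simp add: direct_sum_eq_image card_image card_cartesian_product)
qed

text \<open>The frequency space is itself a direct sum, so sums over frequencies become double sums
  by the same rule as sums over sets.\<close>

lemma direct_sum_vecs: "direct_sum (vecs K m) (vecs K n) = vecs K (m + n)"
proof (intro subset_antisym subsetI)
  fix z assume "z \<in> vecs K (m + n)"
  then have "take m z \<in> vecs K m" "drop m z \<in> vecs K n"
    by (auto simp: vecs_def dest: in_set_takeD in_set_dropD)
  moreover have "z = take m z @ drop m z" by simp
  ultimately show "z \<in> direct_sum (vecs K m) (vecs K n)"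
    unfolding direct_sum_def by blast
qed (auto simp: direct_sum_def vecs_def)

lemma zero_vec_append: "zero_vec K m @ zero_vec K n = zero_vec K (m + n)"
  by (simp add: zero_vec_def replicate_add)

section \<open>Characters, dot products and Fourier transforms over one finite field\<close>

locale finite_field_character = field K for K (structure) +
  fixes \<chi> :: "'a \<Rightarrow> complex"
  assumes finite_carrier: "finite (carrier K)"
    and additive_character: "additive_character K \<chi>"
begin

abbreviation q :: nat where "q \<equiv> card (carrier K)"

lemma q_gt_1: "q > 1"
proof -
  have "card {\<zero>, \<one>} \<le> q"
    using finite_carrier by (intro card_mono) auto
  then show ?thesis by simp
qed

lemma norm_character: "x \<in> carrier K \<Longrightarrow> cmod (\<chi> x) = 1"
  and character_add: "x \<in> carrier K \<Longrightarrow> y \<in> carrier K \<Longrightarrow> \<chi> (x \<oplus> y) = \<chi> x * \<chi> y"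
  using additive_character by (auto simp: additive_character_def)

lemma character_zero: "\<chi> \<zero> = 1"
proof -
  have "\<chi> \<zero> = \<chi> \<zero> * \<chi> \<zero>" using character_add[of \<zero> \<zero>] by simp
  moreover have "\<chi> \<zero> \<noteq> 0" using norm_character[of \<zero>] by auto
  ultimately show ?thesis by simp
qed

lemma finite_vecs: "finite (vecs K n)"
  using finite_lists_length_eq[OF finite_carrier, of n] by (simp add: vecs_def conj_commute)

lemma card_vecs: "card (vecs K n) = q ^ n"
  using card_lists_length_eq[OF finite_carrier, of n] by (simp add: vecs_def conj_commute)

lemma zero_vec_in_vecs: "zero_vec K n \<in> vecs K n"
  by (auto simp: zero_vec_def vecs_def)

lemma nth_in_carrier: "x \<in> vecs K n \<Longrightarrow> i < n \<Longrightarrow> x ! i \<in> carrier K"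
  by (auto simp: vecs_def)

lemma dot_closed: "x \<in> vecs K n \<Longrightarrow> y \<in> vecs K n \<Longrightarrow> dot K n x y \<in> carrier K"
  unfolding dot_def by (intro finsum_closed) (auto intro: nth_in_carrier)

text \<open>Induction on the length of the second half: removing the last entries of
  \<open>y\<close> and \<open>y'\<close> removes the same summand from both sides.\<close>

lemma dot_append:
  assumes "x \<in> vecs K m" "y \<in> vecs K n" "x' \<in> vecs K m" "y' \<in> vecs K n"
  shows "dot K (m + n) (x @ y) (x' @ y') = dot K m x x' \<oplus> dot K n y y'"
  using assms(2,4)
proof (induction n arbitrary: y y' rule: nat.induct)
  case zero
  then show ?case using assms(1,3) dot_closed[OF assms(1,3)] by (simp add: vecs_def dot_def)
next
  case (Suc n)
  have len: "length x = m" "length x' = m" using assms by (auto simp: vecs_def)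
  define z where "z = butlast y"
  define z' where "z' = butlast y'"
  obtain a where y: "y = z @ [a]" "z \<in> vecs K n" "a \<in> carrier K"
    using Suc.prems(1) unfolding z_def
    by (cases y rule: rev_cases) (auto simp: vecs_def)
  obtain a' where y': "y' = z' @ [a']" "z' \<in> vecs K n" "a' \<in> carrier K"
    using Suc.prems(2) unfolding z'_def
    by (cases y' rule: rev_cases) (auto simp: vecs_def)
  \<comment> \<open>Kept general in \<open>j\<close> because it is applied twice: to the
    concatenated vectors of length \<open>m + n\<close>, and to \<open>z\<close> and
    \<open>z'\<close> of length \<open>n\<close>.\<close>
  have snoc: "dot K (Suc j) (u @ [a]) (u' @ [a']) = dot K j u u' \<oplus> a \<otimes> a'"
    if "u \<in> vecs K j" "u' \<in> vecs K j" for j u u'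
  proof -
    have l: "length u = j" "length u' = j" using that by (auto simp: vecs_def)
    have "(\<Oplus>i\<in>{..<j}. (u @ [a]) ! i \<otimes> (u' @ [a']) ! i) = (\<Oplus>i\<in>{..<j}. u ! i \<otimes> u' ! i)"
      by (intro finsum_cong') (use that l in \<open>auto simp: nth_append intro: nth_in_carrier\<close>)
    \<comment> \<open>Side condition for splitting the last term off the ring sum.\<close>
    moreover have "(\<lambda>i. (u @ [a]) ! i \<otimes> (u' @ [a']) ! i) \<in> {..<j} \<rightarrow> carrier K"
      using that l by (auto simp: nth_append intro!: m_closed intro: nth_in_carrier)
    ultimately show ?thesis
      using y(3) y'(3) l that dot_closed[OF that]
      by (simp add: dot_def lessThan_Suc nth_append a_comm)
  qed
  have "x @ z \<in> vecs K (m + n)" "x' @ z' \<in> vecs K (m + n)"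
    using assms y y' by (auto simp: vecs_def)
  from snoc[OF this]
  have "dot K (m + Suc n) (x @ y) (x' @ y') = dot K (m + n) (x @ z) (x' @ z') \<oplus> a \<otimes> a'"
    by (simp add: y y')
  also have "\<dots> = dot K m x x' \<oplus> dot K n z z' \<oplus> a \<otimes> a'"
    by (simp add: Suc.IH y y')
  also have "\<dots> = dot K m x x' \<oplus> dot K (Suc n) y y'"
    using snoc[OF y(2) y'(2)] y y' dot_closed[OF assms(1,3)] dot_closed[OF y(2) y'(2)]
    by (simp add: a_assoc)
  finally show ?case .
qed

text \<open>The dot product of concatenations is a sum, which the character turns into a product of
  phases; the double sum then factors, and so does the normalisation
  \<open>q ^ (m + n)\<close>.\<close>

lemma fourier_direct_sum:
  assumes "E \<subseteq> vecs K m" "F \<subseteq> vecs K n" "x \<in> vecs K m" "y \<in> vecs K n"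
  shows "fourier K \<chi> (m + n) (direct_sum E F) (x @ y) = fourier K \<chi> m E x * fourier K \<chi> n F y"
proof -
  have "\<chi> (\<ominus> dot K (m + n) (x @ y) (x' @ y')) = \<chi> (\<ominus> dot K m x x') * \<chi> (\<ominus> dot K n y y')"
    if "x' \<in> E" "y' \<in> F" for x' y'
  proof -
    have "x' \<in> vecs K m" "y' \<in> vecs K n" using that assms by auto
    then show ?thesis
      using assms by (simp add: dot_append minus_add dot_closed character_add)
  qed
  then have "(\<Sum>z\<in>direct_sum E F. \<chi> (\<ominus> dot K (m + n) (x @ y) z))
      = (\<Sum>x'\<in>E. \<chi> (\<ominus> dot K m x x')) * (\<Sum>y'\<in>F. \<chi> (\<ominus> dot K n y y'))"
    by (simp add: sum_direct_sum[OF assms(1)] sum_product)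
  then show ?thesis
    by (simp add: fourier_def power_add)
qed

text \<open>At the zero frequency every phase is \<open>1\<close>, so the sum just counts the
  set.\<close>

lemma fourier_zero_vec:
  assumes "E \<subseteq> vecs K n"
  shows "fourier K \<chi> n E (zero_vec K n) = of_nat (card E) / of_nat (q ^ n)"
proof -
  have "dot K n (zero_vec K n) y = \<zero>" if "y \<in> E" for y
  proof -
    have "y \<in> vecs K n" using that assms by auto
    then have "dot K n (zero_vec K n) y = (\<Oplus>i\<in>{..<n}. \<zero>)"
      unfolding dot_def zero_vec_def
      by (intro finsum_cong') (auto simp: nth_in_carrier)
    then show ?thesis by simp
  qed
  then show ?thesis by (simp add: fourier_def character_zero)
qed

text \<open>Triangle inequality with phases of modulus one. It covers the zero frequency as well,
  where it is an equality.\<close>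

lemma norm_fourier_le:
  assumes "E \<subseteq> vecs K n" "x \<in> vecs K n"
  shows "cmod (fourier K \<chi> n E x) \<le> card E / q ^ n"
proof -
  have "cmod (\<Sum>y\<in>E. \<chi> (\<ominus> dot K n x y)) \<le> (\<Sum>y\<in>E. 1)"
  proof (intro sum_norm_le)
    fix y assume "y \<in> E"
    with assms show "cmod (\<chi> (\<ominus> dot K n x y)) \<le> 1"
      by (auto simp: norm_character dot_closed subset_iff)
  qed
  then show ?thesis
    by (simp add: fourier_def norm_divide norm_power divide_right_mono)
qed

section \<open>Fourier norms over nonzero frequencies\<close>

lemma nonzero_vecs_nonempty:
  assumes "n > 0"
  shows "vecs K n - {zero_vec K n} \<noteq> {}"
proof -
  have "replicate n \<one> \<in> vecs K n" by (auto simp: vecs_def)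
  moreover have "replicate n \<one> \<noteq> zero_vec K n"
    using assms by (simp add: zero_vec_def)
  ultimately show ?thesis by blast
qed

lemma norm_fourier_le_fourier_norm_infinity:
  assumes "x \<in> vecs K n" "x \<noteq> zero_vec K n"
  shows "cmod (fourier K \<chi> n E x) \<le> fourier_norm K \<chi> n \<infinity> E"
  unfolding fourier_norm_def
  using assms finite_vecs by (auto intro!: cSUP_upper bdd_above_finite)

text \<open>For \<open>p = \<infinity>\<close> the supremum must range over a nonempty set, and
  \<open>n > 0\<close> supplies a nonzero frequency; for other \<open>p\<close> the value is a
  \<open>powr\<close> and hence nonnegative.\<close>

lemma fourier_norm_nonneg:
  assumes "n > 0"
  shows "fourier_norm K \<chi> n p E \<ge> 0"
proof (cases "p = \<infinity>")
  case True
  obtain x where "x \<in> vecs K n" "x \<noteq> zero_vec K n"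
    using nonzero_vecs_nonempty[OF assms] by auto
  then show ?thesis
    using norm_fourier_le_fourier_norm_infinity[of x n E] True norm_ge_zero order_trans by blast
qed (simp add: fourier_norm_def)

text \<open>The trivial bound: the norm is an average of values that are at most
  \<open>card E / q ^ n\<close>. It handles the pairs of sets for which the logarithmic exponent is
  degenerate.\<close>

lemma fourier_norm_le:
  assumes "E \<subseteq> vecs K n" "n > 0" "p \<ge> 1"
  shows "fourier_norm K \<chi> n p E \<le> card E / q ^ n"
proof (cases "p = \<infinity>")
  case True
  then show ?thesis
    using nonzero_vecs_nonempty[OF assms(2)] norm_fourier_le[OF assms(1)]
    by (auto simp: fourier_norm_def intro!: cSUP_least)
next
  case False
  define r where "r = real_of_ereal p"
  have r: "r \<ge> 1" using assms(3) False by (cases p) (auto simp: r_def)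
  define e where "e = card E / real q ^ n"
  have e: "e \<ge> 0" by (simp add: e_def)
  have "(\<Sum>x\<in>vecs K n - {zero_vec K n}. cmod (fourier K \<chi> n E x) powr r)
      \<le> (\<Sum>x\<in>vecs K n - {zero_vec K n}. e powr r)"
    using r norm_fourier_le[OF assms(1)] by (intro sum_mono powr_mono2) (auto simp: e_def)
  \<comment> \<open>Restoring the zero frequency makes the number of terms exactly
    \<open>q ^ n\<close>, which cancels the normalisation.\<close>
  also have "\<dots> \<le> (\<Sum>x\<in>vecs K n. e powr r)"
    using finite_vecs by (intro sum_mono2) auto
  also have "\<dots> = q ^ n * e powr r"
    by (simp add: card_vecs)
  finally have "(\<Sum>x\<in>vecs K n - {zero_vec K n}. cmod (fourier K \<chi> n E x) powr r) / q ^ n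
      \<le> e powr r"
    using q_gt_1 by (simp add: field_simps)
  then have "fourier_norm K \<chi> n p E \<le> (e powr r) powr (1 / r)"
    using False r unfolding fourier_norm_def r_def
    by (auto intro!: powr_mono2 divide_nonneg_nonneg sum_nonneg)
  also have "\<dots> = e" using r e by (simp add: powr_powr)
  finally show ?thesis by (simp add: e_def)
qed

lemma sum_powr_fourier:
  assumes "r \<ge> 1"
  shows "(\<Sum>x\<in>vecs K n - {zero_vec K n}. cmod (fourier K \<chi> n E x) powr r)
      = q ^ n * fourier_norm K \<chi> n (ereal r) E powr r"
proof -
  define S where "S = (\<Sum>x\<in>vecs K n - {zero_vec K n}. cmod (fourier K \<chi> n E x) powr r)"
  have "S \<ge> 0" by (auto simp: S_def intro: sum_nonneg)
  then have "((S / q ^ n) powr (1 / r)) powr r = S / q ^ n"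
    using assms by (simp add: powr_powr)
  then show ?thesis
    using q_gt_1 by (simp add: fourier_norm_def flip: S_def)
qed

section \<open>Fourier norms of direct sums\<close>

lemma fourier_norm_direct_sum_infinity_le:
  assumes "E \<subseteq> vecs K m" "F \<subseteq> vecs K n" "m > 0" "n > 0"
    and "fourier_norm K \<chi> m \<infinity> E * (card F / q ^ n) \<le> M"
    and "card E / q ^ m * fourier_norm K \<chi> n \<infinity> F \<le> M"
  shows "fourier_norm K \<chi> (m + n) \<infinity> (direct_sum E F) \<le> M"
proof -
  have "cmod (fourier K \<chi> (m + n) (direct_sum E F) z) \<le> M"
    if z: "z \<in> vecs K (m + n)" "z \<noteq> zero_vec K (m + n)" for z
  proof -
    obtain x y where xy: "z = x @ y" "x \<in> vecs K m" "y \<in> vecs K n"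
      using z(1) unfolding direct_sum_vecs[symmetric] direct_sum_def by blast
    have split: "cmod (fourier K \<chi> (m + n) (direct_sum E F) z)
        = cmod (fourier K \<chi> m E x) * cmod (fourier K \<chi> n F y)"
      using assms xy by (simp add: fourier_direct_sum norm_mult)
    \<comment> \<open>Estimate a nonzero half by its norm and the other half by the trivial bound,
      which holds whether or not that half vanishes. Two cases therefore suffice.\<close>
    have "x \<noteq> zero_vec K m \<or> y \<noteq> zero_vec K n"
      using z(2) xy by (auto simp: zero_vec_append)
    then show ?thesis
    proof
      assume "x \<noteq> zero_vec K m"
      then have "cmod (fourier K \<chi> m E x) * cmod (fourier K \<chi> n F y)
          \<le> fourier_norm K \<chi> m \<infinity> E * (card F / q ^ n)"
        using assms xy
        by (intro mult_mono norm_fourier_le norm_fourier_le_fourier_norm_infinity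
              fourier_norm_nonneg) auto
      with split assms(5) show ?thesis by linarith
    next
      assume "y \<noteq> zero_vec K n"
      then have "cmod (fourier K \<chi> m E x) * cmod (fourier K \<chi> n F y)
          \<le> card E / q ^ m * fourier_norm K \<chi> n \<infinity> F"
        using assms xy
        by (intro mult_mono norm_fourier_le norm_fourier_le_fourier_norm_infinity) auto
      with split assms(6) show ?thesis by linarith
    qed
  qed
  then show ?thesis
    using nonzero_vecs_nonempty[of "m + n"] assms(3)
    by (auto simp: fourier_norm_def intro!: cSUP_least)
qed

text \<open>\<open>M1\<close>, \<open>M2\<close>, \<open>M3\<close> control the frequencies with
  both halves nonzero, only \<open>y\<close> nonzero and only \<open>x\<close> nonzero. With one
  half fixed at zero, the normalisation by \<open>q ^ (m + n)\<close> leaves a surplus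
  \<open>1 / q ^ m\<close> or \<open>1 / q ^ n\<close>, whose \<open>r\<close>-th root is the extra
  factor in \<open>M2\<close> and \<open>M3\<close>.\<close>

lemma fourier_norm_direct_sum_le:
  assumes "E \<subseteq> vecs K m" "F \<subseteq> vecs K n" "m > 0" "n > 0" "r \<ge> 1"
    and M1: "fourier_norm K \<chi> m (ereal r) E * fourier_norm K \<chi> n (ereal r) F \<le> M"
    and M2: "card E / q ^ m * fourier_norm K \<chi> n (ereal r) F * q powr (- (m / r)) \<le> M"
    and M3: "fourier_norm K \<chi> m (ereal r) E * (card F / q ^ n) * q powr (- (n / r)) \<le> M"
  shows "fourier_norm K \<chi> (m + n) (ereal r) (direct_sum E F) \<le> 3 * M"
proof -
  define u where "u = fourier_norm K \<chi> m (ereal r) E"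
  define v where "v = fourier_norm K \<chi> n (ereal r) F"
  define e where "e = card E / real q ^ m"
  define f where "f = card F / real q ^ n"
  define w where "w = fourier_norm K \<chi> (m + n) (ereal r) (direct_sum E F)"
  have nonneg: "u \<ge> 0" "v \<ge> 0" "e \<ge> 0" "f \<ge> 0" "w \<ge> 0"
    using assms fourier_norm_nonneg by (auto simp: u_def v_def e_def f_def w_def)
  have M: "M \<ge> 0" using M1 nonneg by (smt (verit) u_def v_def mult_nonneg_nonneg)
  have q0: "real q > 0" using q_gt_1 by simp
  \<comment> \<open>Moves the surplus factor inside the power, so that each term becomes an
    \<open>r\<close>-th power comparable with \<open>M powr r\<close>.\<close>
  have powr_q: "(q powr (- (l / r))) powr r = 1 / q ^ l" for l :: nat
  proof -
    have "(q powr (- (l / r))) powr r = q powr (- real l)"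
      using assms(5) by (simp add: powr_powr)
    then show ?thesis using q0 by (simp add: powr_minus_divide powr_realpow)
  qed
  have total: "(\<Sum>x\<in>vecs K l. cmod (fourier K \<chi> l A x) powr r)
      = q ^ l * fourier_norm K \<chi> l (ereal r) A powr r + (card A / q ^ l) powr r"
    if "A \<subseteq> vecs K l" for l A
    using sum_powr_fourier[OF assms(5), of l A] fourier_zero_vec[OF that]
      sum.remove[OF finite_vecs zero_vec_in_vecs, of "\<lambda>x. cmod (fourier K \<chi> l A x) powr r" l]
    by (simp add: norm_divide norm_power)
  have EF: "direct_sum E F \<subseteq> vecs K (m + n)"
    using assms(1,2) unfolding direct_sum_vecs[symmetric] direct_sum_def by blast
  have card_EF: "card (direct_sum E F) / q ^ (m + n) = e * f"
    by (simp add: card_direct_sum[OF assms(1)] e_def f_def power_add)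
  \<comment> \<open>With the zero frequency included, the double sum factors into two full sums,
    each given by \<open>total\<close>.\<close>
  have "(\<Sum>z\<in>vecs K (m + n). cmod (fourier K \<chi> (m + n) (direct_sum E F) z) powr r)
      = (\<Sum>x\<in>vecs K m. \<Sum>y\<in>vecs K n.
          cmod (fourier K \<chi> m E x) powr r * cmod (fourier K \<chi> n F y) powr r)"
    unfolding direct_sum_vecs[symmetric] sum_direct_sum[OF subset_refl]
    using assms by (intro sum.cong refl) (simp add: fourier_direct_sum norm_mult powr_mult)
  also have "\<dots> = (q ^ m * u powr r + e powr r) * (q ^ n * v powr r + f powr r)"
    unfolding sum_product[symmetric] total[OF assms(1)] total[OF assms(2)]
    by (simp add: u_def v_def e_def f_def)
  finally have "q ^ (m + n) * w powr r + (e * f) powr r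
      = (q ^ m * u powr r + e powr r) * (q ^ n * v powr r + f powr r)"
    using total[OF EF] card_EF by (simp add: w_def)
  \<comment> \<open>The origin contributes \<open>(e * f) powr r\<close> to both sides; cancelling
    it leaves the three classes of nonzero frequencies.\<close>
  then have "q ^ m * q ^ n * w powr r = q ^ m * q ^ n * (u powr r * v powr r)
      + q ^ n * (e powr r * v powr r) + q ^ m * (u powr r * f powr r)"
    using nonneg by (simp add: powr_mult power_add algebra_simps)
  then have "w powr r = (u powr r * v powr r) + e powr r * v powr r * (1 / q ^ m)
      + u powr r * f powr r * (1 / q ^ n)"
    using q0 by (simp add: field_simps)
  also have "\<dots> = (u * v) powr r + (e * v * q powr (- (m / r))) powr r
      + (u * f * q powr (- (n / r))) powr r"
    using nonneg by (simp only: powr_mult powr_q mult_nonneg_nonneg powr_ge_zero)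
  also have "\<dots> \<le> M powr r + M powr r + M powr r"
    using assms nonneg by (intro add_mono powr_mono2) (auto simp: u_def v_def e_def f_def)
  \<comment> \<open>Since \<open>r \<ge> 1\<close>, the number of terms is at most
    \<open>3 powr r\<close>, so the constant \<open>3\<close> does not depend on
    \<open>r\<close>.\<close>
  also have "\<dots> = 3 powr 1 * M powr r" by simp
  also have "\<dots> \<le> 3 powr r * M powr r"
    using assms(5) by (intro mult_right_mono powr_mono) auto
  also have "\<dots> = (3 * M) powr r" using M by (simp add: powr_mult)
  finally have "w powr r \<le> (3 * M) powr r" .
  \<comment> \<open>Strict monotonicity of the \<open>r\<close>-th power, used contrapositively,
    removes the power.\<close>
  then show ?thesis
    using M nonneg assms(5) unfolding w_def[symmetric]
    by (smt (verit) powr_less_mono2)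
qed

end

section \<open>Salem bounds uniform in the field order\<close>

lemma salem_infinity_direct_sum:
  fixes K :: "nat \<Rightarrow> ('a, 'm) ring_scheme"
  assumes K: "\<And>q. q \<in> Q \<Longrightarrow> finite_field_character (K q) (\<chi> q)"
    and card: "\<And>q. q \<in> Q \<Longrightarrow> card (carrier (K q)) = q"
    and E: "\<And>q. q \<in> Q \<Longrightarrow> E q \<subseteq> vecs (K q) m"
    and F: "\<And>q. q \<in> Q \<Longrightarrow> F q \<subseteq> vecs (K q) n"
    and mn: "m > 0" "n > 0"
    and "salem Q K \<chi> m \<infinity> s E" "salem Q K \<chi> n \<infinity> t F"
    and s': "\<And>q. q \<in> Q \<Longrightarrow> card (E q) > 0 \<Longrightarrow> card (F q) > 0 \<Longrightarrow>
      card (E q) * card (F q) > 1 \<Longrightarrow>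
      s' q * (ln (card (E q)) + ln (card (F q))) \<le> s q * ln (card (E q)) \<and>
      s' q * (ln (card (E q)) + ln (card (F q))) \<le> t q * ln (card (F q))"
  shows "salem Q K \<chi> (m + n) \<infinity> s' (\<lambda>q. direct_sum (E q) (F q))"
proof -
  obtain a b where a: "a > 0" "\<And>q. q \<in> Q \<Longrightarrow>
      fourier_norm (K q) (\<chi> q) m \<infinity> (E q) \<le> a * (card (E q) powr (1 - s q) / q ^ m)"
    and b: "b > 0" "\<And>q. q \<in> Q \<Longrightarrow>
      fourier_norm (K q) (\<chi> q) n \<infinity> (F q) \<le> b * (card (F q) powr (1 - t q) / q ^ n)"
    using assms(7,8) unfolding salem_def by blast
  \<comment> \<open>One constant for all \<open>q\<close>: \<open>1\<close> serves the trivial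
    bound, \<open>a\<close> and \<open>b\<close> the two bounds that use one Salem hypothesis
    each.\<close>
  define c where "c = 1 + a + b"
  have c: "c \<ge> 1" "c \<ge> a" "c \<ge> b" "c > 0" using a b by (auto simp: c_def)
  have "fourier_norm (K q) (\<chi> q) (m + n) \<infinity> (direct_sum (E q) (F q))
      \<le> c * (card (direct_sum (E q) (F q)) powr (1 - s' q) / q ^ (m + n))" if q: "q \<in> Q" for q
  proof -
    interpret finite_field_character "K q" "\<chi> q" by (rule K[OF q])
    have cq [simp]: "card (carrier (K q)) = q" by (rule card[OF q])
    have q0: "real q > 0" using q_gt_1 by simp
    define x where "x = real (card (E q))"
    define y where "y = real (card (F q))"
    have xy: "card (direct_sum (E q) (F q)) = x * y"
      by (simp add: card_direct_sum[OF E[OF q]] x_def y_def)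
    define u where "u = fourier_norm (K q) (\<chi> q) m \<infinity> (E q)"
    define v where "v = fourier_norm (K q) (\<chi> q) n \<infinity> (F q)"
    have uv: "u \<ge> 0" "v \<ge> 0" "u \<le> x / q ^ m" "v \<le> y / q ^ n"
      using fourier_norm_nonneg mn fourier_norm_le[OF E[OF q] mn(1)]
        fourier_norm_le[OF F[OF q] mn(2)]
      by (auto simp: u_def v_def x_def y_def)
    have "x \<ge> 0" "y \<ge> 0" by (auto simp: x_def y_def)
    define M where "M = c * ((x * y) powr (1 - s' q) / q ^ (m + n))"
    have "u * (y / q ^ n) \<le> M \<and> x / q ^ m * v \<le> M"
    \<comment> \<open>Otherwise \<open>x * y\<close>, being a natural number, is \<open>0\<close> or
      \<open>1\<close>. Then \<open>(x * y) powr (1 - s' q)\<close> equals \<open>x * y\<close>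
      whatever the exponent, and the trivial bound is enough.\<close>
    proof (cases "x * y > 1")
      case False
      have triv: "u * (y / q ^ n) \<le> x / q ^ m * (y / q ^ n)" "x / q ^ m * v \<le> x / q ^ m * (y / q ^ n)"
        using uv \<open>x \<ge> 0\<close> \<open>y \<ge> 0\<close> by (intro mult_mono; simp)+
      have "\<not> card (E q) * card (F q) > 1"
        using False unfolding x_def y_def by (metis of_nat_1 of_nat_less_iff of_nat_mult)
      then have "card (E q) * card (F q) = 0 \<or> card (E q) * card (F q) = 1" by linarith
      then have "x * y = 0 \<or> x * y = 1"
        unfolding x_def y_def by (metis of_nat_0 of_nat_1 of_nat_mult)
      then have "x * y \<le> c * (x * y) powr (1 - s' q)" using c by auto
      then have "x / q ^ m * (y / q ^ n) \<le> M"
        using q0 by (simp add: M_def power_add field_simps)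
      with triv show ?thesis by auto
    next
      case True
      then have pos: "x > 0" "y > 0"
        using \<open>x \<ge> 0\<close> \<open>y \<ge> 0\<close> by (auto simp: less_le)
      have "card (E q) * card (F q) > 1"
        using True unfolding x_def y_def by (metis of_nat_1 of_nat_less_iff of_nat_mult)
      then have le: "s' q * ln (x * y) \<le> s q * ln x" "s' q * ln (x * y) \<le> t q * ln y"
        using s'[OF q] pos by (auto simp: x_def y_def ln_mult_pos)
      \<comment> \<open>Common last step of both estimates: \<open>c'\<close> is the constant of the
        estimate and \<open>A\<close> the numerator that dominates
        \<open>s' q * ln (x * y)\<close>.\<close>
      have step: "c' * ((x * y * exp (- A)) / q ^ (m + n)) \<le> M"
        if "c' \<le> c" "s' q * ln (x * y) \<le> A" for c' A
        unfolding M_def using that c pos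
        by (intro mult_mono divide_right_mono mult_exp_le_powr) auto
      have "u * (y / q ^ n) \<le> a * (x powr (1 - s q) / q ^ m) * (y / q ^ n)"
        using a(2)[OF q] pos by (intro mult_right_mono) (auto simp: u_def x_def)
      also have "\<dots> = a * ((x * y * exp (- (s q * ln x))) / q ^ (m + n))"
        using pos by (simp add: powr_one_minus_eq power_add)
      also have "\<dots> \<le> M" using c le by (intro step)
      finally have 1: "u * (y / q ^ n) \<le> M" .
      have "x / q ^ m * v \<le> x / q ^ m * (b * (y powr (1 - t q) / q ^ n))"
        using b(2)[OF q] pos by (intro mult_left_mono) (auto simp: v_def y_def)
      also have "\<dots> = b * ((x * y * exp (- (t q * ln y))) / q ^ (m + n))"
        using pos by (simp add: powr_one_minus_eq power_add)
      also have "\<dots> \<le> M" using c le by (intro step)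
      finally show ?thesis using 1 by blast
    qed
    then have "fourier_norm (K q) (\<chi> q) (m + n) \<infinity> (direct_sum (E q) (F q)) \<le> M"
      using fourier_norm_direct_sum_infinity_le[OF E[OF q] F[OF q] mn, of M]
      by (simp add: u_def v_def x_def y_def)
    then show ?thesis by (simp only: M_def xy of_nat_power)
  qed
  then show ?thesis unfolding salem_def using c(4) by blast
qed

text \<open>The condition on \<open>s'\<close> is the minimum with denominators cleared, imposed
  where the sum of logarithms is positive. Its inequalities control, in order, the frequencies with
  both halves nonzero, only the second and only the first.\<close>

lemma salem_finite_direct_sum:
  fixes K :: "nat \<Rightarrow> ('a, 'm) ring_scheme"
  assumes K: "\<And>q. q \<in> Q \<Longrightarrow> finite_field_character (K q) (\<chi> q)"
    and card: "\<And>q. q \<in> Q \<Longrightarrow> card (carrier (K q)) = q"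
    and E: "\<And>q. q \<in> Q \<Longrightarrow> E q \<subseteq> vecs (K q) m"
    and F: "\<And>q. q \<in> Q \<Longrightarrow> F q \<subseteq> vecs (K q) n"
    and mn: "m > 0" "n > 0" and r: "r \<ge> 1"
    and "salem Q K \<chi> m (ereal r) s E" "salem Q K \<chi> n (ereal r) t F"
    and s': "\<And>q. q \<in> Q \<Longrightarrow> card (E q) > 0 \<Longrightarrow> card (F q) > 0 \<Longrightarrow>
      card (E q) * card (F q) > 1 \<Longrightarrow>
      s' q * (ln (card (E q)) + ln (card (F q))) \<le> s q * ln (card (E q)) + t q * ln (card (F q)) \<and>
      s' q * (ln (card (E q)) + ln (card (F q))) \<le> m / r * ln q + t q * ln (card (F q)) \<and>
      s' q * (ln (card (E q)) + ln (card (F q))) \<le> s q * ln (card (E q)) + n / r * ln q"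
  shows "salem Q K \<chi> (m + n) (ereal r) s' (\<lambda>q. direct_sum (E q) (F q))"
proof -
  obtain a b where a: "a > 0" "\<And>q. q \<in> Q \<Longrightarrow>
      fourier_norm (K q) (\<chi> q) m (ereal r) (E q) \<le> a * (card (E q) powr (1 - s q) / q ^ m)"
    and b: "b > 0" "\<And>q. q \<in> Q \<Longrightarrow>
      fourier_norm (K q) (\<chi> q) n (ereal r) (F q) \<le> b * (card (F q) powr (1 - t q) / q ^ n)"
    using assms(8,9) unfolding salem_def by blast
  \<comment> \<open>The product \<open>a * b\<close> arises where both Salem hypotheses are applied,
    at frequencies with both halves nonzero.\<close>
  define c where "c = 1 + a + b + a * b"
  have c: "c \<ge> 1" "c \<ge> a" "c \<ge> b" "c \<ge> a * b" "c > 0"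
    using a(1) b(1) mult_pos_pos[OF a(1) b(1)] unfolding c_def by linarith+
  have "fourier_norm (K q) (\<chi> q) (m + n) (ereal r) (direct_sum (E q) (F q))
      \<le> 3 * c * (card (direct_sum (E q) (F q)) powr (1 - s' q) / q ^ (m + n))"
    if q: "q \<in> Q" for q
  proof -
    interpret finite_field_character "K q" "\<chi> q" by (rule K[OF q])
    have cq [simp]: "card (carrier (K q)) = q" by (rule card[OF q])
    have q1: "real q > 1" using q_gt_1 by simp
    then have q0: "real q > 0" by linarith
    define x where "x = real (card (E q))"
    define y where "y = real (card (F q))"
    have xy: "card (direct_sum (E q) (F q)) = x * y"
      by (simp add: card_direct_sum[OF E[OF q]] x_def y_def)
    define u where "u = fourier_norm (K q) (\<chi> q) m (ereal r) (E q)"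
    define v where "v = fourier_norm (K q) (\<chi> q) n (ereal r) (F q)"
    have uv: "u \<ge> 0" "v \<ge> 0" "u \<le> x / q ^ m" "v \<le> y / q ^ n"
      using fourier_norm_nonneg mn fourier_norm_le[OF E[OF q] mn(1)]
        fourier_norm_le[OF F[OF q] mn(2)] r
      by (auto simp: u_def v_def x_def y_def)
    have nonneg: "x \<ge> 0" "y \<ge> 0" by (auto simp: x_def y_def)
    define M where "M = c * ((x * y) powr (1 - s' q) / q ^ (m + n))"
    have "u * v \<le> M \<and> x / q ^ m * v * q powr (- (m / r)) \<le> M
      \<and> u * (y / q ^ n) * q powr (- (n / r)) \<le> M"
    proof (cases "x * y > 1")
      case False
      have q_le: "q powr (- (l / r)) \<le> 1" for l :: nat
        using q1 r powr_mono[of "- (l / r)" 0 "real q"] by simp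
      define z where "z = x / q ^ m * (y / q ^ n)"
      have z: "z \<ge> 0" using nonneg by (simp add: z_def)
      have "u * v \<le> z" "x / q ^ m * v \<le> z" "u * (y / q ^ n) \<le> z"
        unfolding z_def using uv nonneg by (intro mult_mono; simp)+
      moreover have "x / q ^ m * v * q powr (- (m / r)) \<le> z * 1"
        using calculation q_le z by (intro mult_mono) auto
      moreover have "u * (y / q ^ n) * q powr (- (n / r)) \<le> z * 1"
        using calculation q_le z by (intro mult_mono) auto
      moreover have "z \<le> M"
      proof -
        have "\<not> card (E q) * card (F q) > 1"
          using False unfolding x_def y_def by (metis of_nat_1 of_nat_less_iff of_nat_mult)
        then have "card (E q) * card (F q) = 0 \<or> card (E q) * card (F q) = 1" by linarith
        then have "x * y = 0 \<or> x * y = 1"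
          unfolding x_def y_def by (metis of_nat_0 of_nat_1 of_nat_mult)
        then have "x * y \<le> c * (x * y) powr (1 - s' q)" using c by auto
        then show ?thesis
          using q0 by (simp add: M_def z_def power_add field_simps)
      qed
      ultimately show ?thesis by auto
    next
      case True
      then have pos: "x > 0" "y > 0"
        using nonneg by (auto simp: less_le)
      have "card (E q) * card (F q) > 1"
        using True unfolding x_def y_def by (metis of_nat_1 of_nat_less_iff of_nat_mult)
      then have le: "s' q * ln (x * y) \<le> s q * ln x + t q * ln y"
          "s' q * ln (x * y) \<le> m / r * ln q + t q * ln y"
          "s' q * ln (x * y) \<le> s q * ln x + n / r * ln q"
        using s'[OF q] pos by (auto simp: x_def y_def ln_mult_pos)
      have step: "c' * ((x * y * exp (- A)) / q ^ (m + n)) \<le> M"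
        if "c' \<le> c" "s' q * ln (x * y) \<le> A" for c' A
        unfolding M_def using that c pos
        by (intro mult_mono divide_right_mono mult_exp_le_powr) auto
      have u: "u \<le> a * (x * exp (- (s q * ln x)) / q ^ m)"
        using a(2)[OF q] pos by (simp add: u_def x_def powr_one_minus_eq)
      have v: "v \<le> b * (y * exp (- (t q * ln y)) / q ^ n)"
        using b(2)[OF q] pos by (simp add: v_def y_def powr_one_minus_eq)
      \<comment> \<open>In exponential form the surplus factor adds \<open>l / r * ln q\<close> to
        the numerator; this is the origin of the terms with \<open>log q\<close> in the
        exponent.\<close>
      have powr_q: "q powr (- (l / r)) = exp (- (l / r * ln q))" for l :: nat
        using q0 by (simp add: powr_def)
      have "u * v \<le> a * (x * exp (- (s q * ln x)) / q ^ m) * (b * (y * exp (- (t q * ln y)) / q ^ n))"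
        using u v uv a b pos by (intro mult_mono) auto
      also have "\<dots> = (a * b) * ((x * y * exp (- (s q * ln x + t q * ln y))) / q ^ (m + n))"
        unfolding minus_add_distrib exp_add by (simp add: power_add)
      also have "\<dots> \<le> M" using c le by (intro step)
      finally have 1: "u * v \<le> M" .
      have "x / q ^ m * v * q powr (- (m / r))
          \<le> x / q ^ m * (b * (y * exp (- (t q * ln y)) / q ^ n)) * q powr (- (m / r))"
        using v pos by (intro mult_right_mono mult_left_mono) auto
      also have "\<dots> = b * ((x * y * exp (- (m / r * ln q + t q * ln y))) / q ^ (m + n))"
        unfolding powr_q minus_add_distrib exp_add by (simp add: power_add)
      also have "\<dots> \<le> M" using c le by (intro step)
      finally have 2: "x / q ^ m * v * q powr (- (m / r)) \<le> M" .
      have "u * (y / q ^ n) * q powr (- (n / r))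
          \<le> a * (x * exp (- (s q * ln x)) / q ^ m) * (y / q ^ n) * q powr (- (n / r))"
        using u pos by (intro mult_right_mono) auto
      also have "\<dots> = a * ((x * y * exp (- (s q * ln x + n / r * ln q))) / q ^ (m + n))"
        unfolding powr_q minus_add_distrib exp_add by (simp add: power_add)
      also have "\<dots> \<le> M" using c le by (intro step)
      finally show ?thesis using 1 2 by blast
    qed
    then have "fourier_norm (K q) (\<chi> q) (m + n) (ereal r) (direct_sum (E q) (F q)) \<le> 3 * M"
      using fourier_norm_direct_sum_le[OF E[OF q] F[OF q] mn r, of M]
      by (simp add: u_def v_def x_def y_def)
    then show ?thesis by (simp only: M_def xy mult.assoc of_nat_power)
  qed
  then show ?thesis unfolding salem_def using c(5) by (intro exI[of _ "3 * c"]) auto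
qed

section \<open>Exponents as quotients of logarithms\<close>

theorem theorem3p2:
  fixes Q :: "nat set"
    and K :: "nat \<Rightarrow> ('a, 'm) ring_scheme"
    and \<chi> :: "nat \<Rightarrow> 'a \<Rightarrow> complex"
    and E F :: "nat \<Rightarrow> 'a list set"
    and s t :: "nat \<Rightarrow> real"
    and d k :: nat
    and p :: ereal
  assumes "\<forall>q\<in>Q. primepow q"
    and "\<forall>q\<in>Q. field (K q) \<and> card (carrier (K q)) = q"
    and "\<forall>q\<in>Q. nontrivial_additive_character (K q) (\<chi> q)"
    and "d \<ge> 2" and "1 \<le> k" and "k < d"
    and "\<forall>q\<in>Q. E q \<subseteq> vecs (K q) k"
    and "\<forall>q\<in>Q. F q \<subseteq> vecs (K q) (d - k)"
    and "p \<ge> 1"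
  shows "(salem Q K \<chi> k p s E \<and> salem Q K \<chi> (d - k) p t F \<longrightarrow>
           salem Q K \<chi> d p
             (\<lambda>q. min (min
                ((s q * ln (card (E q)) + t q * ln (card (F q)))
                   / (ln (card (E q)) + ln (card (F q))))
                ((real_of_ereal (ereal (real k) / p) * ln q + t q * ln (card (F q)))
                   / (ln (card (E q)) + ln (card (F q)))))
                ((s q * ln (card (E q)) + real_of_ereal (ereal (real (d - k)) / p) * ln q)
                   / (ln (card (E q)) + ln (card (F q)))))
             (\<lambda>q. direct_sum (E q) (F q)))
       \<and> (salem Q K \<chi> k \<infinity> s E \<and> salem Q K \<chi> (d - k) \<infinity> t F \<longrightarrow>
           salem Q K \<chi> d \<infinity>
             (\<lambda>q. min (s q * ln (card (E q))) (t q * ln (card (F q)))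
                   / (ln (card (E q)) + ln (card (F q))))
             (\<lambda>q. direct_sum (E q) (F q)))"
proof -
  define n where "n = d - k"
  have d: "d = k + n" and mn: "k > 0" "n > 0" using assms(5,6) by (auto simp: n_def)
  have card: "card (carrier (K q)) = q" if "q \<in> Q" for q
    using assms(2) that by blast
  have K: "finite_field_character (K q) (\<chi> q)" if q: "q \<in> Q" for q
  proof -
    interpret field "K q" using assms(2) q by blast
    \<comment> \<open>An infinite carrier would have \<open>card\<close> equal to \<open>0\<close>,
      so positivity of \<open>q\<close> yields finiteness.\<close>
    have "q > 0" using assms(1) q primepow_gt_0_nat by blast
    then have "finite (carrier (K q))" using card[OF q] card_ge_0_finite by metis
    then show ?thesis
      using assms(3) q by unfold_locales (auto simp: nontrivial_additive_character_def)
  qed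
  have E: "E q \<subseteq> vecs (K q) k" and F: "F q \<subseteq> vecs (K q) n" if "q \<in> Q" for q
    using assms(7,8) that by (auto simp: n_def)
  have dk: "d - k = n" by (simp add: n_def)
  \<comment> \<open>Positivity of the denominator allows the quotients in the exponent to be
    multiplied out.\<close>
  have ln_card: "ln (card (E q)) + ln (card (F q)) > 0"
    if "card (E q) > 0" "card (F q) > 0" "card (E q) * card (F q) > 1" for q
  proof -
    have "real (card (E q) * card (F q)) > 1" using that(3) by (metis of_nat_1 of_nat_less_iff)
    then have "ln (real (card (E q) * card (F q))) > 0" by (rule ln_gt_zero)
    then show ?thesis using that by (simp add: ln_mult_pos)
  qed
  have min_divide: "min A B / L * L \<le> A" "min A B / L * L \<le> B"
    and min3: "min (min (A / L) (B / L)) (C / L) * L \<le> A"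
      "min (min (A / L) (B / L)) (C / L) * L \<le> B" "min (min (A / L) (B / L)) (C / L) * L \<le> C"
    if "L > 0" for A B C L :: real
    using that by (auto simp: min_def field_simps)
  show ?thesis
  proof (intro conjI impI; elim conjE)
    assume salem: "salem Q K \<chi> k p s E" "salem Q K \<chi> (d - k) p t F"
    show "salem Q K \<chi> d p
             (\<lambda>q. min (min
                ((s q * ln (card (E q)) + t q * ln (card (F q)))
                   / (ln (card (E q)) + ln (card (F q))))
                ((real_of_ereal (ereal (real k) / p) * ln q + t q * ln (card (F q)))
                   / (ln (card (E q)) + ln (card (F q)))))
                ((s q * ln (card (E q)) + real_of_ereal (ereal (real (d - k)) / p) * ln q)
                   / (ln (card (E q)) + ln (card (F q)))))
             (\<lambda>q. direct_sum (E q) (F q))"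
    proof (cases p)
      case (real r)
      then have r: "r \<ge> 1" using assms(9) by simp
      have div: "real_of_ereal (ereal (real l) / ereal r) = l / r" for l
        using r by simp
      show ?thesis
        unfolding real div dk unfolding d
        by (rule salem_finite_direct_sum[OF K card E F mn r salem[unfolded real dk]])
           (assumption | rule conjI min3 ln_card)+
    next
      case PInf
      \<comment> \<open>The \<open>log q\<close> terms vanish, so the second and third quotients
        become \<open>t q * ln (card (F q))\<close> and \<open>s q * ln (card (E q))\<close> over
        the denominator: exactly the two inequalities needed for the supremum norm.\<close>
      have div: "real_of_ereal (ereal (real l) / \<infinity>) = 0" for l
        by simp
      show ?thesis
        unfolding PInf div mult_zero_left add_0_left add_0_right unfolding d
        by (rule salem_infinity_direct_sum[OF K card E F mn salem[unfolded PInf dk]])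
           (assumption | rule conjI min3 ln_card)+
    qed (use assms(9) in simp)
  next
    assume salem: "salem Q K \<chi> k \<infinity> s E" "salem Q K \<chi> (d - k) \<infinity> t F"
    show "salem Q K \<chi> d \<infinity>
             (\<lambda>q. min (s q * ln (card (E q))) (t q * ln (card (F q)))
                   / (ln (card (E q)) + ln (card (F q))))
             (\<lambda>q. direct_sum (E q) (F q))"
      unfolding d
      by (rule salem_infinity_direct_sum[OF K card E F mn salem[unfolded dk]])
         (assumption | rule conjI min_divide ln_card)+
  qed
qed

end
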